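(* Suppose that $S:\mathbb{R}^n\to\mathbb{R}^n$ is nonexpansive and $\bar\alpha\in(0,1)$. Then every sequence generated by the line search iteration (with nominal step length $\bar\alpha$) satisfies, for every integer $N\ge 0$, $$\sum_{k=0}^{N}\|\bar r^k-r^k\|_2^2\le\frac{\bar\alpha}{1-\bar\alpha}\|r^0\|_2^2.$$ Moreover, let $k_{\rm best}^N\in\{0,\dots,N\}$ be an index $k$ (up to $N$) for which $\|\bar r^k-r^k\|_2$ is smallest. Then $$\|\bar r^{k_{\rm best}^N}-r^{k_{\rm best}^N}\|_2^2\le\frac{\bar\alpha}{(N+1)(1-\bar\alpha)}\|r^0\|_2^2.$$
   Context: $\|\cdot\|_2$ is the Euclidean norm on $\mathbb{R}^n$. $S$ is nonexpansive if $\|Su-Sv\|_2\le\|u-v\|_2$ for all $u,v\in\mathbb{R}^n$. Line search iteration: fix algorithm parameters $\bar\alpha\in(0,1)$ (nominal step length), $\epsilon\in(0,1)$ and $\alpha^{\max}\ge\bar\alpha$, and an arbitrary starting point $x^0\in\mathbb{R}^n$. For $k=0,1,2,\dots$ set $$r^k:=Sx^k-x^k,\qquad \bar x^k:=x^k+\bar\alpha r^k,\qquad \bar r^k:=S\bar x^k-\bar x^k,\qquad x^{k+1}:=x^k+\alpha_k r^k,$$ where for each $k$ the step length $\alpha_k$ satisfies: either $\alpha_k=\bar\alpha$, or $\alpha_k\in(\bar\alpha,\alpha^{\max}]$ is such that the line search test $\|r^{k+1}\|_2=\|Sx^{k+1}-x^{k+1}\|_2\le(1-\epsilon)\|\bar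 r^k\|_2$ holds. The choice of $\alpha_k$ is otherwise arbitrary. *)

theory Defs
  imports "HOL-Analysis.Analysis"
begin

definition nonexpansive :: "(real ^ 'n \<Rightarrow> real ^ 'n) \<Rightarrow> bool" where
  "nonexpansive S \<longleftrightarrow> (\<forall>u v. norm (S u - S v) \<le> norm (u - v))"

definition residual :: "(real ^ 'n \<Rightarrow> real ^ 'n) \<Rightarrow> real ^ 'n \<Rightarrow> real ^ 'n" where
  "residual S x = S x - x"

definition nominal_point ::
    "(real ^ 'n \<Rightarrow> real ^ 'n) \<Rightarrow> real \<Rightarrow> real ^ 'n \<Rightarrow> real ^ 'n" where
  "nominal_point S abar x = x + abar *\<^sub>R residual S x"

definition nominal_residual ::
    "(real ^ 'n \<Rightarrow> real ^ 'n) \<Rightarrow> real \<Rightarrow> real ^ 'n \<Rightarrow> real ^ 'n" where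
  "nominal_residual S abar x = residual S (nominal_point S abar x)"

text \<open>
  The sequence \<open>x\<close> is generated by the line search iteration with the step lengths
  \<open>\<alpha>\<close>, nominal step length \<open>abar\<close>, line search parameter \<open>\<epsilon>\<close> and
  maximal step length \<open>amax\<close>. The starting point \<open>x 0\<close> is unconstrained. The
  step lengths need not be a function of the iterates, nor does a longer step have to be
  taken whenever one passes the test.
\<close>

definition line_search_iteration ::
    "(real ^ 'n \<Rightarrow> real ^ 'n) \<Rightarrow> real \<Rightarrow> real \<Rightarrow> real
      \<Rightarrow> (nat \<Rightarrow> real) \<Rightarrow> (nat \<Rightarrow> real ^ 'n) \<Rightarrow> bool" where
  "line_search_iteration S abar \<epsilon> amax \<alpha> x \<longleftrightarrow>
     (\<forall>k. x (Suc k) = x k + \<alpha> k *\<^sub>R residual S (x k) \<and>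
          (\<alpha> k = abar \<or>
           \<alpha> k \<in> {abar<..amax} \<and>
           norm (residual S (x (Suc k))) \<le> (1 - \<epsilon>) * norm (nominal_residual S abar (x k))))"

end

theory Submission
  imports Defs
begin

text \<open>
  Write \<open>r\<close> for the residual at \<open>u\<close>, \<open>r'\<close> for the residual at the nominal point
  \<open>u + abar r\<close>, and \<open>d = r' - r\<close>. The nominal step moves the argument of \<open>S\<close> by \<open>abar r\<close> and its
  value by \<open>d + abar r\<close>, so nonexpansiveness says \<open>\<parallel>d + abar r\<parallel> \<le> \<parallel>abar r\<parallel>\<close>, that is
  \<open>\<parallel>d\<parallel>\<^sup>2 + 2 abar \<langle>d, r\<rangle> \<le> 0\<close>. The inner product is known from
  \<open>\<parallel>r'\<parallel>\<^sup>2 = \<parallel>r\<parallel>\<^sup>2 + 2 \<langle>d, r\<rangle> + \<parallel>d\<parallel>\<^sup>2\<close>; eliminating it bounds \<open>(1 - abar) \<parallel>d\<parallel>\<^sup>2\<close> by \<open>abar\<close> times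
  the decrease of the squared residual norm over the nominal step (\<open>nominal_step_decrease\<close>).

  A longer step is accepted only if the residual norm at the next iterate does not exceed
  \<open>\<parallel>r'\<parallel>\<close>, so the decrease over an actual step is at least that over the nominal one
  (\<open>line_search_residual_le\<close>). The bounds on the individual \<open>\<parallel>d\<parallel>\<^sup>2\<close> therefore telescope. The
  smallest of the \<open>N + 1\<close> summands is at most their average, which gives the rate for the best
  index.
\<close>

text \<open>
  The only use of nonexpansiveness, at the two points \<open>nominal_point S a u\<close> and \<open>u\<close>. With
  \<open>0 < a < 1\<close> it shows in particular that a nominal step does not increase the residual norm.
\<close>

lemma nominal_step_decrease:
  assumes "nonexpansive S"
  shows "(1 - a) * (norm (nominal_residual S a u - residual S u))\<^sup>2
           \<le> a * ((norm (residual S u))\<^sup>2 - (norm (nominal_residual S a u))\<^sup>2)"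
proof -
  define r where "r = residual S u"
  define r' where "r' = nominal_residual S a u"
  define d where "d = r' - r"
  have "d + a *\<^sub>R r = S (nominal_point S a u) - S u"
    by (simp add: d_def r_def r'_def nominal_residual_def nominal_point_def residual_def)
  moreover have "a *\<^sub>R r = nominal_point S a u - u"
    by (simp add: r_def nominal_point_def)
  ultimately have "norm (d + a *\<^sub>R r) \<le> norm (a *\<^sub>R r)"
    using assms by (simp add: nonexpansive_def)
  then have "(norm (d + a *\<^sub>R r))\<^sup>2 \<le> (norm (a *\<^sub>R r))\<^sup>2"
    by (simp add: power_mono)
  then have nonexp: "(norm d)\<^sup>2 + 2 * a * (d \<bullet> r) \<le> 0"
    by (simp add: power2_norm_eq_inner inner_add_left inner_add_right inner_commute algebra_simps
        del: norm_scaleR)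
  have "r' = r + d"
    by (simp add: d_def)
  then have "2 * (d \<bullet> r) = (norm r')\<^sup>2 - (norm r)\<^sup>2 - (norm d)\<^sup>2"
    by (simp add: power2_norm_eq_inner inner_add_left inner_add_right inner_commute)
  then have "2 * a * (d \<bullet> r) = a * ((norm r')\<^sup>2 - (norm r)\<^sup>2 - (norm d)\<^sup>2)"
    by (simp add: mult.assoc mult.left_commute)
  with nonexp have "(1 - a) * (norm d)\<^sup>2 \<le> a * ((norm r)\<^sup>2 - (norm r')\<^sup>2)"
    by (simp add: algebra_simps)
  then show ?thesis
    by (simp add: d_def r_def r'_def)
qed

lemma line_search_residual_le:
  assumes "line_search_iteration S abar \<epsilon> amax \<alpha> x" and "0 \<le> \<epsilon>"
  shows "norm (residual S (x (Suc k))) \<le> norm (nominal_residual S abar (x k))"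
proof -
  have step: "x (Suc k) = x k + \<alpha> k *\<^sub>R residual S (x k)"
    and "\<alpha> k = abar \<or> norm (residual S (x (Suc k))) \<le> (1 - \<epsilon>) * norm (nominal_residual S abar (x k))"
    using assms(1) by (auto simp: line_search_iteration_def)
  then consider "\<alpha> k = abar"
    | "norm (residual S (x (Suc k))) \<le> (1 - \<epsilon>) * norm (nominal_residual S abar (x k))"
    by blast
  then show ?thesis
  proof cases
    case 1
    with step show ?thesis
      by (simp add: nominal_residual_def nominal_point_def)
  next
    case 2
    also have "(1 - \<epsilon>) * norm (nominal_residual S abar (x k)) \<le> norm (nominal_residual S abar (x k))"
      using assms(2) by (simp add: mult_left_le_one_le algebra_simps)
    finally show ?thesis .
  qed
qed

theorem theorem4:
  fixes S :: "real ^ 'n \<Rightarrow> real ^ 'n"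
    and abar \<epsilon> amax :: real
    and \<alpha> :: "nat \<Rightarrow> real"
    and x :: "nat \<Rightarrow> real ^ 'n"
    and N :: nat
  assumes "nonexpansive S"
    and "0 < abar" and "abar < 1"
    and "0 < \<epsilon>" and "\<epsilon> < 1"
    and "abar \<le> amax"
    and "line_search_iteration S abar \<epsilon> amax \<alpha> x"
  shows "(\<Sum>k=0..N. (norm (nominal_residual S abar (x k) - residual S (x k)))\<^sup>2)
           \<le> abar / (1 - abar) * (norm (residual S (x 0)))\<^sup>2
       \<and> (\<forall>k_best. is_arg_min (\<lambda>k. norm (nominal_residual S abar (x k) - residual S (x k)))
                      (\<lambda>k. k \<in> {0..N}) k_best
            \<longrightarrow> (norm (nominal_residual S abar (x k_best) - residual S (x k_best)))\<^sup>2
                 \<le> abar / ((real N + 1) * (1 - abar)) * (norm (residual S (x 0)))\<^sup>2)"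
proof (intro conjI allI impI)
  define d where "d k = norm (nominal_residual S abar (x k) - residual S (x k))" for k
  define r where "r k = (norm (residual S (x k)))\<^sup>2" for k
  have step: "(1 - abar) * (d k)\<^sup>2 \<le> abar * (r k - r (Suc k))" for k
  proof -
    have "(1 - abar) * (d k)\<^sup>2 \<le> abar * (r k - (norm (nominal_residual S abar (x k)))\<^sup>2)"
      using nominal_step_decrease[OF \<open>nonexpansive S\<close>] by (simp add: d_def r_def)
    also have "\<dots> \<le> abar * (r k - r (Suc k))"
      using line_search_residual_le[OF assms(7)] \<open>0 < \<epsilon>\<close> \<open>0 < abar\<close>
      by (simp add: r_def power_mono)
    finally show ?thesis .
  qed
  have "(1 - abar) * (\<Sum>k=0..N. (d k)\<^sup>2) \<le> (\<Sum>k=0..N. abar * (r k - r (Suc k)))"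
    unfolding sum_distrib_left by (intro sum_mono step)
  also have "\<dots> = abar * (r 0 - r (Suc N))"
    by (simp add: sum_telescope atLeast0AtMost flip: sum_distrib_left)
  also have "\<dots> \<le> abar * r 0"
    using \<open>0 < abar\<close> by (simp add: r_def)
  finally have sum_le: "(\<Sum>k=0..N. (d k)\<^sup>2) \<le> abar / (1 - abar) * r 0"
    using \<open>abar < 1\<close> by (simp add: field_simps)
  then show "(\<Sum>k=0..N. (norm (nominal_residual S abar (x k) - residual S (x k)))\<^sup>2)
               \<le> abar / (1 - abar) * (norm (residual S (x 0)))\<^sup>2"
    by (simp add: d_def r_def)

  fix k_best
  assume "is_arg_min (\<lambda>k. norm (nominal_residual S abar (x k) - residual S (x k)))
            (\<lambda>k. k \<in> {0..N}) k_best"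
  then have "d k_best \<le> d k" if "k \<in> {0..N}" for k
    using that by (auto simp: is_arg_min_linorder d_def)
  then have "(d k_best)\<^sup>2 \<le> (d k)\<^sup>2" if "k \<in> {0..N}" for k
    using that by (simp add: d_def power_mono)
  then have "(\<Sum>k=0..N. (d k_best)\<^sup>2) \<le> (\<Sum>k=0..N. (d k)\<^sup>2)"
    by (intro sum_mono)
  with sum_le have "(real N + 1) * (d k_best)\<^sup>2 \<le> abar / (1 - abar) * r 0"
    by (simp add: add.commute)
  then have "(d k_best)\<^sup>2 \<le> abar / (1 - abar) * r 0 / (real N + 1)"
    by (subst pos_le_divide_eq) (simp_all add: mult.commute)
  then show "(norm (nominal_residual S abar (x k_best) - residual S (x k_best)))\<^sup>2
               \<le> abar / ((real N + 1) * (1 - abar)) * (norm (residual S (x 0)))\<^sup>2"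
    by (simp add: d_def r_def mult.commute)
qed

end
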